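(* Let $\mathcal{L}=\langle S, Act_\tau,\to\rangle$ be a finite-branching labelled transition system of processes, and let $\mathcal{T}=\langle T,Act_\tau\cup\{\omega\},\to\rangle$ be a labelled transition system of tests with finitely many states in which every state has only finitely many outgoing transitions. Then every test $t\in T$ is may-representable: there exists a (closed) formula $\phi\in\mathrm{recHML}$ such that for every $p\in S$, $p\ \mathbf{may\ satisfy}\ t$ if and only if $p\in[\![\phi]\!]$.
   Context: **Labelled transition systems.** An LTS over a countable set $Act$ of external actions is a triple $\langle S,Act_\tau,\to\rangle$ with $S$ a countable set of states (processes), $Act_\tau=Act\cup\{\tau\}$ where $\tau\notin Act$, and $\to\subseteq S\times Act_\tau\times S$; write $s\xrightarrow{\alpha}s'$ for $(s,\alpha,s')\in\to$, and $s\xrightarrow{\alpha}$ if such an $s'$ exists. The letter $a$ ranges over $Act$, $\alpha$ over $Act_\tau$. $\mathrm{Succ}(s)=\{s' : s\xrightarrow{\alpha}s'\text{ for some }\alpha\in Act_\tau\}$; the LTS of processes is finite branching if $\mathrm{Succ}(s)$ is finite for all $s\in S$. $s\Uparrow$ (diverges) if there is an infinite path $s\xrightarrow{\tau}s_1\xrightarrow{\tau}\cdots$; otherwise $s\Downarrow$ (converges). Weak transitions: $\stackrel{\tau}{\Rightarrow}$ is the reflexive transitive closure of $\xrightarrow{\tau}$, and $s\stackrel{a}{\Rightarrow}s'$ means $s\stackrel{\tau}{\Rightarrow}s''\xrightarrow{a}s'''\stackrel{\tau}{\Rightarrow}s'$ for some $s'',s'''$; $s\stackrel{\alpha}{\Rightarrow}$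 means $s\stackrel{\alpha}{\Rightarrow}s'$ for some $s'$. **The language recHML.** It is the set of closed formulae generated by $\phi ::= \mathtt{tt}\mid\mathtt{ff}\mid X\mid \mathrm{Acc}\,A\mid\phi_1\vee\phi_2\mid\phi_1\wedge\phi_2\mid\langle\alpha\rangle\phi\mid[\alpha]\phi\mid\min(X,\phi)\mid\max(X,\phi)$, where $X$ ranges over a countable set $Var$ of variables, $\alpha\in Act_\tau$, $A$ is a finite subset of $Act$, and $\min(X,\cdot)$, $\max(X,\cdot)$ bind $X$. Given an environment $\rho:Var\to 2^S$: $[\![\mathtt{tt}]\!]\rho=S$; $[\![\mathtt{ff}]\!]\rho=\emptyset$; $[\![X]\!]\rho=\rho(X)$; $[\![\mathrm{Acc}\,A]\!]\rho=\{s : s\Downarrow,\text{ and } s\stackrel{\tau}{\Rightarrow}s'\text{ implies } s'\stackrel{a}{\Rightarrow}\text{ for some }a\in A\}$; $[\![\langle\alpha\rangle\phi]\!]\rho=\{s : s\stackrel{\alpha}{\Rightarrow}s'\text{ for some }s'\in[\![\phi]\!]\rho\}$; $[\![[\alpha]\phi]\!]\rho=\{s : s\Downarrow,\text{ and } s\stackrel{\alpha}{\Rightarrow}s'\text{ implies }s'\in[\![\phi]\!]\rho\}$; $\vee,\wedge$ are union and intersection; $[\![\min(X,\phi)]\!]\rho=\bigcap\{P\subseteq S : [\![\phi]\!]\rho[X\mapsto P]\subseteq P\}$; $[\![\max(X,\phi)]\!]\rho=\bigcup\{P\subseteq S : P\subseteq[\![\phi]\!]\rho[X\mapsto P]\}$.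 For closed $\phi$ the environment is omitted. **Tests.** A test is a state of an LTS $\mathcal{T}=\langle T,Act_\tau\cup\{\omega\},\to\rangle$, where $\omega\notin Act_\tau$ is a special success action. **Testing.** For a process $p$ and test $t$, the experiment $p\,|\,t$ has only $\tau$-moves: $p|t\to p'|t$ if $p\xrightarrow{\tau}p'$; $p|t\to p|t'$ if $t\xrightarrow{\tau}t'$; $p|t\to p'|t'$ if $p\xrightarrow{a}p'$ and $t\xrightarrow{a}t'$ for some $a\in Act$. A computation of $p|t$ is a maximal (finite or infinite) path $p|t\to p_1|t_1\to\cdots$ (with $p_0=p$, $t_0=t$); it is successful if $t_n\xrightarrow{\omega}$ for some $n\ge0$. $p\ \mathbf{may\ satisfy}\ t$ if there exists a successful computation of $p|t$. *)

theory Defs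
  imports Main "HOL-Library.Countable_Set" "HOL-Library.Extended_Nat"
begin

text \<open>
  Action alphabets and state spaces are carrier sets, so they may be empty, finite or countably
  infinite. The constructors make \<open>\<tau>\<close> and the success action \<open>\<omega>\<close> distinct from
  every external action.
\<close>

datatype 'a act = Tau | Ext 'a

datatype 'a test_act = Prc "'a act" | Omega

definition acts :: "'a set \<Rightarrow> 'a act set" where
  "acts Act = insert Tau (Ext ` Act)"

definition test_acts :: "'a set \<Rightarrow> 'a test_act set" where
  "test_acts Act = insert Omega (Prc ` acts Act)"

definition lts :: "'s set \<Rightarrow> 'l set \<Rightarrow> ('s \<times> 'l \<times> 's) set \<Rightarrow> bool" where
  "lts S L tr \<longleftrightarrow> countable S \<and> countable L \<and> tr \<subseteq> S \<times> L \<times> S"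

definition Succ :: "('s \<times> 'l \<times> 's) set \<Rightarrow> 's \<Rightarrow> 's set" where
  "Succ tr s = {s'. \<exists>l. (s, l, s') \<in> tr}"

definition finite_branching :: "'s set \<Rightarrow> ('s \<times> 'l \<times> 's) set \<Rightarrow> bool" where
  "finite_branching S tr \<longleftrightarrow> (\<forall>s\<in>S. finite (Succ tr s))"

definition diverges :: "('s \<times> 'a act \<times> 's) set \<Rightarrow> 's \<Rightarrow> bool" where
  "diverges tr s \<longleftrightarrow> (\<exists>f :: nat \<Rightarrow> 's. f 0 = s \<and> (\<forall>i. (f i, Tau, f (Suc i)) \<in> tr))"

abbreviation converges :: "('s \<times> 'a act \<times> 's) set \<Rightarrow> 's \<Rightarrow> bool" where
  "converges tr s \<equiv> \<not> diverges tr s"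

definition arrow :: "('s \<times> 'l \<times> 's) set \<Rightarrow> 'l \<Rightarrow> ('s \<times> 's) set" where
  "arrow tr l = {(s, s'). (s, l, s') \<in> tr}"

fun weak :: "('s \<times> 'a act \<times> 's) set \<Rightarrow> 'a act \<Rightarrow> ('s \<times> 's) set" where
  "weak tr Tau = (arrow tr Tau)\<^sup>*"
| "weak tr (Ext a) = (arrow tr Tau)\<^sup>* O arrow tr (Ext a) O (arrow tr Tau)\<^sup>*"

text \<open>
  The variables are the natural numbers, a countably infinite set. The datatype gives raw
  formulae; \<open>recHML Act\<close> below cuts out the closed ones whose modalities and
  acceptance sets respect the alphabet \<open>Act\<close>.
\<close>

datatype 'a fm =
    TT
  | FF
  | Var nat
  | Acc "'a set"
  | Or "'a fm" "'a fm"
  | And "'a fm" "'a fm"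
  | Dia "'a act" "'a fm"
  | Box "'a act" "'a fm"
  | MinF nat "'a fm"
  | MaxF nat "'a fm"

primrec over :: "'a set \<Rightarrow> 'a fm \<Rightarrow> bool" where
  "over Act TT \<longleftrightarrow> True"
| "over Act FF \<longleftrightarrow> True"
| "over Act (Var X) \<longleftrightarrow> True"
| "over Act (Acc A) \<longleftrightarrow> finite A \<and> A \<subseteq> Act"
| "over Act (Or \<phi> \<psi>) \<longleftrightarrow> over Act \<phi> \<and> over Act \<psi>"
| "over Act (And \<phi> \<psi>) \<longleftrightarrow> over Act \<phi> \<and> over Act \<psi>"
| "over Act (Dia \<alpha> \<phi>) \<longleftrightarrow> \<alpha> \<in> acts Act \<and> over Act \<phi>"
| "over Act (Box \<alpha> \<phi>) \<longleftrightarrow> \<alpha> \<in> acts Act \<and> over Act \<phi>"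
| "over Act (MinF X \<phi>) \<longleftrightarrow> over Act \<phi>"
| "over Act (MaxF X \<phi>) \<longleftrightarrow> over Act \<phi>"

primrec fv :: "'a fm \<Rightarrow> nat set" where
  "fv TT = {}"
| "fv FF = {}"
| "fv (Var X) = {X}"
| "fv (Acc A) = {}"
| "fv (Or \<phi> \<psi>) = fv \<phi> \<union> fv \<psi>"
| "fv (And \<phi> \<psi>) = fv \<phi> \<union> fv \<psi>"
| "fv (Dia \<alpha> \<phi>) = fv \<phi>"
| "fv (Box \<alpha> \<phi>) = fv \<phi>"
| "fv (MinF X \<phi>) = fv \<phi> - {X}"
| "fv (MaxF X \<phi>) = fv \<phi> - {X}"

definition recHML :: "'a set \<Rightarrow> 'a fm set" where
  "recHML Act = {\<phi>. over Act \<phi> \<and> fv \<phi> = {}}"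

primrec sem :: "'s set \<Rightarrow> ('s \<times> 'a act \<times> 's) set \<Rightarrow> 'a fm \<Rightarrow> (nat \<Rightarrow> 's set) \<Rightarrow> 's set" where
  "sem S tr TT \<rho> = S"
| "sem S tr FF \<rho> = {}"
| "sem S tr (Var X) \<rho> = \<rho> X"
| "sem S tr (Acc A) \<rho> =
    {s \<in> S. converges tr s \<and>
      (\<forall>s'. (s, s') \<in> weak tr Tau \<longrightarrow> (\<exists>a\<in>A. \<exists>s''. (s', s'') \<in> weak tr (Ext a)))}"
| "sem S tr (Or \<phi> \<psi>) \<rho> = sem S tr \<phi> \<rho> \<union> sem S tr \<psi> \<rho>"
| "sem S tr (And \<phi> \<psi>) \<rho> = sem S tr \<phi> \<rho> \<inter> sem S tr \<psi> \<rho>"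
| "sem S tr (Dia \<alpha> \<phi>) \<rho> = {s \<in> S. \<exists>s'. (s, s') \<in> weak tr \<alpha> \<and> s' \<in> sem S tr \<phi> \<rho>}"
| "sem S tr (Box \<alpha> \<phi>) \<rho> =
    {s \<in> S. converges tr s \<and> (\<forall>s'. (s, s') \<in> weak tr \<alpha> \<longrightarrow> s' \<in> sem S tr \<phi> \<rho>)}"
| "sem S tr (MinF X \<phi>) \<rho> = \<Inter>{P. P \<subseteq> S \<and> sem S tr \<phi> (\<rho>(X := P)) \<subseteq> P}"
| "sem S tr (MaxF X \<phi>) \<rho> = \<Union>{P. P \<subseteq> S \<and> P \<subseteq> sem S tr \<phi> (\<rho>(X := P))}"

lemma sem_cong_fv:
  "(\<And>X. X \<in> fv \<phi> \<Longrightarrow> \<rho> X = \<rho>' X) \<Longrightarrow> sem S tr \<phi> \<rho> = sem S tr \<phi> \<rho>'"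
proof (induction \<phi> arbitrary: \<rho> \<rho>')
  case (Or \<phi> \<psi>)
  then have "sem S tr \<phi> \<rho> = sem S tr \<phi> \<rho>'" "sem S tr \<psi> \<rho> = sem S tr \<psi> \<rho>'"
    by (metis UnCI fv.simps(5))+
  then show ?case by simp
next
  case (And \<phi> \<psi>)
  then have "sem S tr \<phi> \<rho> = sem S tr \<phi> \<rho>'" "sem S tr \<psi> \<rho> = sem S tr \<psi> \<rho>'"
    by (metis UnCI fv.simps(6))+
  then show ?case by simp
next
  case (Dia \<alpha> \<phi>)
  then have "sem S tr \<phi> \<rho> = sem S tr \<phi> \<rho>'" by (metis fv.simps(7))
  then show ?case by simp
next
  case (Box \<alpha> \<phi>)
  then have "sem S tr \<phi> \<rho> = sem S tr \<phi> \<rho>'" by (metis fv.simps(8))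
  then show ?case by simp
next
  case (MinF X \<phi>)
  have "sem S tr \<phi> (\<rho>(X := P)) = sem S tr \<phi> (\<rho>'(X := P))" for P
    by (rule MinF.IH) (use MinF.prems in auto)
  then show ?case by simp
next
  case (MaxF X \<phi>)
  have "sem S tr \<phi> (\<rho>(X := P)) = sem S tr \<phi> (\<rho>'(X := P))" for P
    by (rule MaxF.IH) (use MaxF.prems in auto)
  then show ?case by simp
qed auto

text \<open>The environment is irrelevant for closed formulae, by \<open>sem_cong_fv\<close>.\<close>

definition csem :: "'s set \<Rightarrow> ('s \<times> 'a act \<times> 's) set \<Rightarrow> 'a fm \<Rightarrow> 's set" where
  "csem S tr \<phi> = sem S tr \<phi> (\<lambda>_. {})"

text \<open>The pair \<open>(p, t)\<close> is the experiment \<open>p | t\<close>.\<close>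

inductive exp_step ::
  "('s \<times> 'a act \<times> 's) set \<Rightarrow> ('t \<times> 'a test_act \<times> 't) set \<Rightarrow> 's \<times> 't \<Rightarrow> 's \<times> 't \<Rightarrow> bool"
  for trS trT where
  proc: "(p, Tau, p') \<in> trS \<Longrightarrow> exp_step trS trT (p, t) (p', t)"
| test: "(t, Prc Tau, t') \<in> trT \<Longrightarrow> exp_step trS trT (p, t) (p, t')"
| sync: "(p, Ext a, p') \<in> trS \<Longrightarrow> (t, Prc (Ext a), t') \<in> trT \<Longrightarrow> exp_step trS trT (p, t) (p', t')"

text \<open>
  A path with \<open>n\<close> moves (\<open>n = \<infinity>\<close> for an infinite path) is given by its states
  \<open>c 0, c 1, \<dots>\<close>; if \<open>n\<close> is finite, the values of \<open>c\<close> beyond \<open>n\<close> are ignored. The last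
  conjunct is maximality.
\<close>

definition computation ::
  "('s \<times> 'a act \<times> 's) set \<Rightarrow> ('t \<times> 'a test_act \<times> 't) set \<Rightarrow> 's \<Rightarrow> 't \<Rightarrow>
    (nat \<Rightarrow> 's \<times> 't) \<Rightarrow> enat \<Rightarrow> bool" where
  "computation trS trT p t c n \<longleftrightarrow>
    c 0 = (p, t) \<and>
    (\<forall>i. enat i < n \<longrightarrow> exp_step trS trT (c i) (c (Suc i))) \<and>
    (\<forall>i. n = enat i \<longrightarrow> (\<nexists>e. exp_step trS trT (c i) e))"

definition successful ::
  "('t \<times> 'a test_act \<times> 't) set \<Rightarrow> (nat \<Rightarrow> 's \<times> 't) \<Rightarrow> enat \<Rightarrow> bool" where
  "successful trT c n \<longleftrightarrow> (\<exists>i. enat i \<le> n \<and> (\<exists>t'. (snd (c i), Omega, t') \<in> trT))"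

definition may_satisfy ::
  "('s \<times> 'a act \<times> 's) set \<Rightarrow> ('t \<times> 'a test_act \<times> 't) set \<Rightarrow> 's \<Rightarrow> 't \<Rightarrow> bool" where
  "may_satisfy trS trT p t \<longleftrightarrow> (\<exists>c n. computation trS trT p t c n \<and> successful trT c n)"

definition may_representable ::
  "'a set \<Rightarrow> 's set \<Rightarrow> ('s \<times> 'a act \<times> 's) set \<Rightarrow> ('t \<times> 'a test_act \<times> 't) set \<Rightarrow> 't \<Rightarrow> bool" where
  "may_representable Act S trS trT t \<longleftrightarrow>
    (\<exists>\<phi>\<in>recHML Act. \<forall>p\<in>S. may_satisfy trS trT p t \<longleftrightarrow> p \<in> csem S trS \<phi>)"

end

theory Submission
  imports Defs
begin

text \<open>
  A process may satisfy \<open>t\<close> iff \<open>p | t\<close> can reach an experiment whose test component reports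
  success. This is a least fixed point over the finitely many tests, which is written as a nested
  \<open>min\<close>-formula by unfolding the transition graph of \<open>t\<close>: the tests on the current branch are
  bound variables, and meeting one of them again yields its variable. The formula is complete
  because, by induction on \<open>n\<close>, every pre-fixed point of a \<open>min\<close>-body contains the processes that
  succeed within \<open>n\<close> steps.
\<close>

section \<open>Successful computations and moves of an experiment\<close>

definition succeeds :: "('t \<times> 'a test_act \<times> 't) set \<Rightarrow> 't \<Rightarrow> bool" where
  "succeeds trT t \<longleftrightarrow> (\<exists>t'. (t, Omega, t') \<in> trT)"

text \<open>Success at the start does not by itself give a computation, which has to be maximal;
  iterating a chosen successor extends any experiment to one.\<close>

lemma maximal_path_exists:
  "\<exists>c n. computation trS trT p t c n"
proof -
  define next_exp where
    "next_exp e = (SOME e'. exp_step trS trT e e')" for e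
  define c where "c i = (next_exp ^^ i) (p, t)" for i
  let ?stuck = "\<lambda>i. \<nexists>e. exp_step trS trT (c i) e"
  have step: "exp_step trS trT (c i) (c (Suc i))" if "\<not> ?stuck i" for i
    using that by (auto simp: c_def next_exp_def intro: someI)
  show ?thesis
  proof (cases "\<exists>i. ?stuck i")
    case True
    \<comment> \<open>Past a stuck experiment \<open>c\<close> takes arbitrary values, so the path
      has to end at the first stuck index.\<close>
    then have "?stuck (LEAST i. ?stuck i)" by (rule LeastI_ex)
    moreover have "\<not> ?stuck i" if "i < (LEAST i. ?stuck i)" for i
      using not_less_Least[OF that] by blast
    ultimately have "computation trS trT p t c (enat (LEAST i. ?stuck i))"
      using step by (auto simp: computation_def c_def)
    then show ?thesis by blast
  next
    case False
    then have "computation trS trT p t c \<infinity>"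
      using step by (auto simp: computation_def c_def)
    then show ?thesis by blast
  qed
qed

lemma may_satisfy_succeeds:
  assumes "succeeds trT t"
  shows "may_satisfy trS trT p t"
proof -
  obtain c n where c: "computation trS trT p t c n"
    using maximal_path_exists[of trS trT p t] by blast
  then have "successful trT c n"
    using assms unfolding successful_def succeeds_def computation_def
    by (intro exI[of _ 0]) (auto simp flip: zero_enat_def)
  with c show ?thesis unfolding may_satisfy_def by blast
qed

lemma may_satisfy_step:
  assumes step: "exp_step trS trT (p, t) (p', t')" and may: "may_satisfy trS trT p' t'"
  shows "may_satisfy trS trT p t"
proof -
  obtain c n where c: "computation trS trT p' t' c n" and s: "successful trT c n"
    using may unfolding may_satisfy_def by blast
  let ?c = "case_nat (p, t) c"
  have "computation trS trT p t ?c (eSuc n)"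
    unfolding computation_def
  proof (intro conjI allI impI)
    fix i
    assume "enat i < eSuc n"
    then show "exp_step trS trT (?c i) (?c (Suc i))"
      using c step by (cases i) (auto simp: computation_def simp flip: eSuc_enat)
  next
    fix i
    assume "eSuc n = enat i"
    then obtain j where "i = Suc j" "n = enat j"
      by (cases i) (auto simp: zero_enat_def[symmetric] simp flip: eSuc_enat)
    then show "\<nexists>e. exp_step trS trT (?c i) e"
      using c by (simp add: computation_def)
  qed simp
  moreover obtain i where "enat i \<le> n" "\<exists>t''. (snd (c i), Omega, t'') \<in> trT"
    using s unfolding successful_def by blast
  then have "successful trT ?c (eSuc n)"
    unfolding successful_def by (intro exI[of _ "Suc i"]) (simp flip: eSuc_enat)
  ultimately show ?thesis unfolding may_satisfy_def by blast
qed

lemma may_satisfy_weak_Tau: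
  assumes "(p, p') \<in> (arrow trS Tau)\<^sup>*" and "may_satisfy trS trT p' t"
  shows "may_satisfy trS trT p t"
  using assms
  by (induction rule: converse_rtrancl_induct)
     (auto simp: arrow_def intro: may_satisfy_step exp_step.proc)

text \<open>The silent moves around the visible one are moves of the process alone, so the test
  stays put and they can be prepended one by one; only the middle move synchronises. For
  \<open>Tau\<close> the test moves alone, after the process.\<close>

lemma may_satisfy_weak:
  assumes weak: "(p, p') \<in> weak trS \<alpha>" and tr: "(t, Prc \<alpha>, t') \<in> trT"
    and may: "may_satisfy trS trT p' t'"
  shows "may_satisfy trS trT p t"
proof (cases \<alpha>)
  case Tau
  then have "may_satisfy trS trT p' t"
    using tr may by (blast intro: may_satisfy_step exp_step.test)
  with weak Tau show ?thesis by (auto intro: may_satisfy_weak_Tau)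
next
  case (Ext a)
  then obtain q q' where q: "(p, q) \<in> (arrow trS Tau)\<^sup>*" "(q, Ext a, q') \<in> trS"
      "(q', p') \<in> (arrow trS Tau)\<^sup>*"
    using weak by (auto simp: arrow_def)
  then have "may_satisfy trS trT q' t'" using may by (blast intro: may_satisfy_weak_Tau)
  then have "may_satisfy trS trT q t"
    using q(2) tr Ext by (blast intro: may_satisfy_step exp_step.sync)
  with q(1) show ?thesis by (rule may_satisfy_weak_Tau)
qed

lemma weak_single:
  assumes "(p, \<alpha>, p') \<in> trS"
  shows "(p, p') \<in> weak trS \<alpha>"
  using assms by (cases \<alpha>) (auto simp: arrow_def)

section \<open>Success within n moves: finite approximants of the least fixed point\<close>

primrec may_within ::
  "('s \<times> 'a act \<times> 's) set \<Rightarrow> ('t \<times> 'a test_act \<times> 't) set \<Rightarrow> nat \<Rightarrow> 't \<Rightarrow> 's set" where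
  "may_within trS trT 0 t = {p. succeeds trT t}"
| "may_within trS trT (Suc n) t = {p. succeeds trT t \<or>
    (\<exists>p' t'. exp_step trS trT (p, t) (p', t') \<and> p' \<in> may_within trS trT n t')}"

lemma may_within_Suc: "may_within trS trT n t \<subseteq> may_within trS trT (Suc n) t"
proof (induction n arbitrary: t)
  case (Suc n)
  then show ?case unfolding may_within.simps(2) by blast
qed auto

lemma may_within_if_may_satisfy:
  assumes "may_satisfy trS trT p t"
  shows "\<exists>n. p \<in> may_within trS trT n t"
proof -
  obtain c n i where c: "computation trS trT p t c n" and i: "enat i \<le> n"
    and s: "succeeds trT (snd (c i))"
    using assms unfolding may_satisfy_def successful_def succeeds_def by blast
  \<comment> \<open>Walk backwards from the successful index \<open>i\<close>; k = i reaches the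
    initial experiment.\<close>
  have "fst (c (i - k)) \<in> may_within trS trT k (snd (c (i - k)))" if "k \<le> i" for k
    using that
  proof (induction k)
    case 0
    then show ?case using s by simp
  next
    case (Suc k)
    have "enat (i - Suc k) < enat i" using Suc.prems by simp
    also note i
    finally have "exp_step trS trT (c (i - Suc k)) (c (Suc (i - Suc k)))"
      using c unfolding computation_def by blast
    moreover have "Suc (i - Suc k) = i - k" using Suc.prems by simp
    ultimately have "exp_step trS trT (c (i - Suc k)) (c (i - k))" by simp
    then show ?case using Suc
      by (auto intro!: exI[of _ "fst (c (i - k))"] exI[of _ "snd (c (i - k))"])
  qed
  from this[of i] show ?thesis using c by (auto simp: computation_def)
qed

section \<open>Finite disjunctions\<close>

definition big_or :: "'b set \<Rightarrow> ('b \<Rightarrow> 'a fm) \<Rightarrow> 'a fm" where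
  "big_or A f = foldr (\<lambda>x. Or (f x)) (SOME xs. set xs = A) FF"

context
  fixes A :: "'b set"
  assumes finite: "finite A"
begin

lemma set_some_list: "set (SOME xs. set xs = A) = A"
  using finite_list[OF finite] by (rule someI_ex)

lemma fv_big_or: "fv (big_or A f) = (\<Union>x\<in>A. fv (f x))"
proof -
  have "fv (foldr (\<lambda>x. Or (f x)) xs FF) = (\<Union>x\<in>set xs. fv (f x))" for xs
    by (induction xs) auto
  then show ?thesis by (simp add: big_or_def set_some_list)
qed

lemma over_big_or: "over Act (big_or A f) \<longleftrightarrow> (\<forall>x\<in>A. over Act (f x))"
proof -
  have "over Act (foldr (\<lambda>x. Or (f x)) xs FF) \<longleftrightarrow> (\<forall>x\<in>set xs. over Act (f x))" for xs
    by (induction xs) auto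
  then show ?thesis by (simp add: big_or_def set_some_list)
qed

lemma sem_big_or: "sem S tr (big_or A f) \<rho> = (\<Union>x\<in>A. sem S tr (f x) \<rho>)"
proof -
  have "sem S tr (foldr (\<lambda>x. Or (f x)) xs FF) \<rho> = (\<Union>x\<in>set xs. sem S tr (f x) \<rho>)" for xs
    by (induction xs) auto
  then show ?thesis by (simp add: big_or_def set_some_list)
qed

end

section \<open>The formula of a test\<close>

definition moves :: "('t \<times> 'a test_act \<times> 't) set \<Rightarrow> 't \<Rightarrow> ('a act \<times> 't) set" where
  "moves trT t = {(\<alpha>, t'). (t, Prc \<alpha>, t') \<in> trT}"

text \<open>
  \<open>V\<close> holds the tests whose variables are bound on the current branch. The first argument is fuel;
  its value is irrelevant once it exceeds the number of tests outside \<open>V\<close>. The disjunct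
  \<open>Dia Tau (Var _)\<close> makes every pre-fixed point absorb \<open>\<tau>\<close>-moves of the process alone.
\<close>

primrec may_fm ::
  "('t \<Rightarrow> nat) \<Rightarrow> ('t \<times> 'a test_act \<times> 't) set \<Rightarrow> nat \<Rightarrow> 't set \<Rightarrow> 't \<Rightarrow> 'a fm" where
  "may_fm idx trT 0 V t = FF"
| "may_fm idx trT (Suc k) V t =
    (if succeeds trT t then TT
     else if t \<in> V then Var (idx t)
     else MinF (idx t) (Or (Dia Tau (Var (idx t)))
       (big_or (moves trT t) (\<lambda>(\<alpha>, t'). Dia \<alpha> (may_fm idx trT k (insert t V) t')))))"

locale finite_tests =
  fixes Act :: "'a set" and T :: "'t set" and trT :: "('t \<times> 'a test_act \<times> 't) set"
    and idx :: "'t \<Rightarrow> nat"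
  assumes trT_subset: "trT \<subseteq> T \<times> test_acts Act \<times> T"
    and finite_T: "finite T"
    and finite_moves: "t \<in> T \<Longrightarrow> finite (moves trT t)"
    and inj_idx: "inj_on idx T"
begin

lemma movesD:
  assumes "(\<alpha>, t') \<in> moves trT t"
  shows "\<alpha> \<in> acts Act" "t' \<in> T" "(t, Prc \<alpha>, t') \<in> trT"
  using assms trT_subset by (auto simp: moves_def test_acts_def)

lemma over_may_fm: "t \<in> T \<Longrightarrow> over Act (may_fm idx trT k V t)"
proof (induction k arbitrary: V t)
  case (Suc k)
  have "\<alpha> \<in> acts Act \<and> over Act (may_fm idx trT k (insert t V) t')"
    if "(\<alpha>, t') \<in> moves trT t" for \<alpha> t'
    using Suc.IH movesD[OF that] by blast
  moreover have "Tau \<in> acts Act" by (simp add: acts_def)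
  ultimately show ?case using Suc.prems by (auto simp: over_big_or finite_moves)
qed simp

lemma fv_may_fm: "t \<in> T \<Longrightarrow> fv (may_fm idx trT k V t) \<subseteq> idx ` V"
proof (induction k arbitrary: V t)
  case (Suc k)
  have "fv (may_fm idx trT k (insert t V) t') \<subseteq> insert (idx t) (idx ` V)"
    if "(\<alpha>, t') \<in> moves trT t" for \<alpha> t'
    using Suc.IH[of t' "insert t V"] movesD[OF that] by simp
  then have "(\<Union>(\<alpha>, t')\<in>moves trT t. fv (may_fm idx trT k (insert t V) t'))
      \<subseteq> insert (idx t) (idx ` V)"
    by blast
  then show ?case
    using Suc.prems by (auto simp: fv_big_or finite_moves case_prod_unfold)
qed simp

text \<open>Injectivity of \<open>idx\<close> prevents the binder of \<open>t\<close> from capturing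
  the variable of another test on the branch.\<close>

lemma upd_idx:
  assumes "V \<subseteq> T" "t \<in> T" "v \<in> insert t V" "t \<notin> V"
  shows "(\<rho>(idx t := P)) (idx v) = (if v = t then P else \<rho> (idx v))"
  using assms inj_idx by (auto dest: inj_onD)

text \<open>The processes that may satisfy \<open>t\<close> form a pre-fixed point of the
  \<open>MinF\<close> body, so the least one lies inside. Exhausted fuel gives \<open>FF\<close>,
  which is sound.\<close>

lemma sem_may_fm_sound:
  assumes "t \<in> T" "V \<subseteq> T" "\<And>v. v \<in> V \<Longrightarrow> \<rho> (idx v) \<subseteq> {p \<in> S. may_satisfy trS trT p v}"
  shows "sem S trS (may_fm idx trT k V t) \<rho> \<subseteq> {p \<in> S. may_satisfy trS trT p t}"
  using assms
proof (induction k arbitrary: V t \<rho>)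
  case (Suc k)
  let ?M = "\<lambda>t. {p \<in> S. may_satisfy trS trT p t}"
  consider "succeeds trT t" | "\<not> succeeds trT t" "t \<in> V" | "\<not> succeeds trT t" "t \<notin> V"
    by blast
  then show ?case
  proof cases
    case 1
    then show ?thesis by (auto intro: may_satisfy_succeeds)
  next
    case 2
    then show ?thesis using Suc.prems by simp
  next
    case 3
    let ?\<rho> = "\<rho>(idx t := ?M t)"
    have sub: "sem S trS (may_fm idx trT k (insert t V) t') ?\<rho> \<subseteq> ?M t'"
      if "(\<alpha>, t') \<in> moves trT t" for \<alpha> t'
    proof (rule Suc.IH)
      show "?\<rho> (idx v) \<subseteq> ?M v" if "v \<in> insert t V" for v
        using Suc.prems 3 that by (subst upd_idx) auto
    qed (use Suc.prems movesD[OF that] in auto)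
    have "p \<in> ?M t"
      if "p \<in> S" "(p, p') \<in> weak trS \<alpha>" "(\<alpha>, t') \<in> moves trT t"
        "p' \<in> sem S trS (may_fm idx trT k (insert t V) t') ?\<rho>" for p p' \<alpha> t'
      using that sub[OF that(3)] movesD(3)[OF that(3)] by (auto intro: may_satisfy_weak)
    then have "sem S trS (Or (Dia Tau (Var (idx t)))
        (big_or (moves trT t) (\<lambda>(\<alpha>, t'). Dia \<alpha> (may_fm idx trT k (insert t V) t')))) ?\<rho> \<subseteq> ?M t"
      using Suc.prems
      by (auto simp: sem_big_or finite_moves split: prod.splits intro: may_satisfy_weak_Tau)
    moreover have "?M t \<subseteq> S" by blast
    ultimately show ?thesis using 3
      by (simp only: may_fm.simps if_False sem.simps(9)) (rule Inter_lower, blast)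
  qed
qed simp

text \<open>Outer induction on the fuel, and for each pre-fixed point \<open>P\<close> an inner
  induction on n. The strict bound on the cardinality excludes fuel 0, where \<open>FF\<close> would
  lose processes.\<close>

lemma sem_may_fm_complete:
  assumes trS: "trS \<subseteq> S \<times> acts Act \<times> S"
    and "t \<in> T" "V \<subseteq> T" "card (T - V) < k"
    and "\<And>v. v \<in> V \<Longrightarrow> S \<inter> may_within trS trT n v \<subseteq> \<rho> (idx v)"
  shows "S \<inter> may_within trS trT n t \<subseteq> sem S trS (may_fm idx trT k V t) \<rho>"
  using assms(2-)
proof (induction k arbitrary: V t \<rho> n)
  case (Suc k)
  let ?W = "\<lambda>n t. S \<inter> may_within trS trT n t"
  consider "succeeds trT t" | "\<not> succeeds trT t" "t \<in> V" | "\<not> succeeds trT t" "t \<notin> V"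
    by blast
  then show ?case
  proof cases
    case 1
    then show ?thesis by auto
  next
    case 2
    then show ?thesis using Suc.prems by simp
  next
    case 3
    let ?body = "Or (Dia Tau (Var (idx t)))
      (big_or (moves trT t) (\<lambda>(\<alpha>, t'). Dia \<alpha> (may_fm idx trT k (insert t V) t')))"
    \<comment> \<open>Binding \<open>t\<close> uses up one test, which pays for the unit of fuel
      spent.\<close>
    have "card (T - insert t V) < card (T - V)"
      using 3 Suc.prems(1) finite_T by (intro psubset_card_mono) auto
    then have card: "card (T - insert t V) < k" using Suc.prems by simp
    note IH_k = Suc.IH
    have "?W n t \<subseteq> P" if P: "sem S trS ?body (\<rho>(idx t := P)) \<subseteq> P" for P
      using Suc.prems(4)
    proof (induction n)
      case 0
      then show ?case using 3 by simp
    next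
      case (Suc m)
      \<comment> \<open>The approximants grow with n, so the assumption on the environment descends
        from \<open>Suc m\<close> to \<open>m\<close>.\<close>
      have W: "?W m v \<subseteq> \<rho> (idx v)" if "v \<in> V" for v
        using Suc.prems[OF that] may_within_Suc by fast
      then have IH: "?W m t \<subseteq> P" by (rule Suc.IH)
      have sub: "?W m t' \<subseteq> sem S trS (may_fm idx trT k (insert t V) t') (\<rho>(idx t := P))"
        if "t' \<in> T" for t'
      proof (rule IH_k)
        show "?W m v \<subseteq> (\<rho>(idx t := P)) (idx v)" if "v \<in> insert t V" for v
          using \<open>t \<in> T\<close> \<open>V \<subseteq> T\<close> 3 that W IH by (subst upd_idx) auto
      qed (use \<open>t \<in> T\<close> \<open>V \<subseteq> T\<close> that card in auto)
      show ?case
      proof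
        fix p
        assume "p \<in> ?W (Suc m) t"
        then obtain p' t' where p: "p \<in> S" and step: "exp_step trS trT (p, t) (p', t')"
          and p': "p' \<in> may_within trS trT m t'"
          using 3 by auto
        have p'S: "p' \<in> S" using step p trS by cases auto
        \<comment> \<open>Covers both kinds of step in which the test moves: the disjunct for that
          move puts \<open>p\<close> into the body, hence into \<open>P\<close>.\<close>
        have move: "p \<in> P" if "(p, p') \<in> weak trS \<alpha>" "(t, Prc \<alpha>, t') \<in> trT" for \<alpha>
        proof -
          have m: "(\<alpha>, t') \<in> moves trT t" using that by (simp add: moves_def)
          then have "p' \<in> sem S trS (may_fm idx trT k (insert t V) t') (\<rho>(idx t := P))"
            using sub[OF movesD(2)] p'S p' by blast
          then have "p \<in> sem S trS ?body (\<rho>(idx t := P))"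
            using that(1) m p \<open>t \<in> T\<close> by (auto simp: sem_big_or finite_moves intro!: bexI[OF _ m])
          then show ?thesis using P by blast
        qed
        from step show "p \<in> P"
        proof cases
          case proc
          \<comment> \<open>Here the test is still \<open>t\<close>, so the inner induction applies
            to \<open>p'\<close>, and the disjunct \<open>Dia Tau (Var (idx t))\<close> carries
            membership back to \<open>p\<close>.\<close>
          then have "p' \<in> P" using IH p'S p' by auto
          moreover have "(p, p') \<in> weak trS Tau" using proc(2) by (rule weak_single)
          ultimately have "p \<in> sem S trS (Dia Tau (Var (idx t))) (\<rho>(idx t := P))"
            using p unfolding sem.simps(3,7) by force
          then have "p \<in> sem S trS ?body (\<rho>(idx t := P))" by (simp only: sem.simps(5) UnI1)
          then show ?thesis using P by blast
        next
          case test
          then show ?thesis by (intro move[of Tau]) simp_all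
        next
          case (sync a)
          then show ?thesis by (intro move[of "Ext a"] weak_single)
        qed
      qed
    qed
    then show ?thesis using 3
      by (simp only: may_fm.simps if_False sem.simps(9)) (rule Inter_greatest, blast)
  qed
qed simp

end

theorem theorem5p2:
  fixes Act :: "'a set"
    and S :: "'s set" and trS :: "('s \<times> 'a act \<times> 's) set"
    and T :: "'t set" and trT :: "('t \<times> 'a test_act \<times> 't) set"
  assumes "countable Act"
    and "lts S (acts Act) trS"
    and "finite_branching S trS"
    and "lts T (test_acts Act) trT"
    and "finite T"
    and "\<forall>t\<in>T. finite {(l, t'). (t, l, t') \<in> trT}"
  shows "\<forall>t\<in>T. may_representable Act S trS trT t"
proof
  fix t
  assume t: "t \<in> T"
  obtain idx :: "'t \<Rightarrow> nat" where idx: "inj_on idx T"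
    using finite_imp_inj_to_nat_seg[OF \<open>finite T\<close>] by blast
  have "finite (moves trT s)" if "s \<in> T" for s
  proof -
    \<comment> \<open>Preimages of finite sets under an injection are finite.\<close>
    have "moves trT s = map_prod Prc id -` {(l, t'). (s, l, t') \<in> trT}"
      by (auto simp: moves_def)
    moreover have "inj (map_prod Prc id :: 'a act \<times> 't \<Rightarrow> 'a test_act \<times> 't)"
      by (intro prod.inj_map) (auto intro: injI)
    ultimately show ?thesis using assms(6) that finite_vimageI by metis
  qed
  then interpret finite_tests Act T trT idx
    using assms idx by unfold_locales (auto simp: lts_def)
  \<comment> \<open>With no test bound yet, all of \<open>T\<close> is outstanding, so
    \<open>Suc (card T)\<close> is the least fuel meeting the strict bound; the empty
    \<open>V\<close> makes the formula closed.\<close>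
  let ?\<phi> = "may_fm idx trT (Suc (card T)) {} t"
  have "?\<phi> \<in> recHML Act"
    using over_may_fm[OF t] fv_may_fm[OF t, of _ "{}"] by (simp add: recHML_def del: may_fm.simps)
  moreover have "may_satisfy trS trT p t \<longleftrightarrow> p \<in> csem S trS ?\<phi>" if p: "p \<in> S" for p
  proof
    assume "may_satisfy trS trT p t"
    then obtain n where "p \<in> may_within trS trT n t"
      by (blast dest: may_within_if_may_satisfy)
    moreover have "S \<inter> may_within trS trT n t \<subseteq> csem S trS ?\<phi>"
      unfolding csem_def
      by (rule sem_may_fm_complete) (use t assms(2) in \<open>auto simp: lts_def\<close>)
    ultimately show "p \<in> csem S trS ?\<phi>" using p by blast
  next
    assume "p \<in> csem S trS ?\<phi>"
    moreover have "csem S trS ?\<phi> \<subseteq> {p \<in> S. may_satisfy trS trT p t}"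
      unfolding csem_def by (rule sem_may_fm_sound) (use t in auto)
    ultimately show "may_satisfy trS trT p t" by blast
  qed
  ultimately show "may_representable Act S trS trT t"
    unfolding may_representable_def by blast
qed

end
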